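(* Let $G$ be a finite simple undirected graph, $\mathcal{M}$ an MCB of $G$, and let distinct cycles $C_1,C_2\in\mathcal{M}$ share at least two vertices. Then there exists a cycle $C_1'$ such that (1) $\mathcal{M}'=(\mathcal{M}\setminus\{C_1\})\cup\{C_1'\}$ is an MCB, and (2) the intersection of $C_1'$ and $C_2$ (common vertices and edges) is a single path.
   Context: Let $G=(V,E)$ be a finite simple undirected graph. A cycle is a set $C\subseteq E$ such that every vertex of $G$ has even degree in the subgraph with edge set $C$; $|C|$ denotes its number of edges. The cycles form a vector space over $GF(2)$ under symmetric difference $\oplus$. A minimum cycle basis (MCB) is a basis $\mathcal{M}$ of this space minimizing $\sum_{B\in\mathcal{M}}|B|$. Elements of an MCB are edge sets of simple cycles (circuits) of $G$. *)

theory Defs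
  imports
    Main
    "HOL-Library.Function_Algebras"
    "HOL-Library.Indicator_Function"
    "HOL-Library.Z2"
begin

definition simple_graph :: "'v set \<Rightarrow> 'v set set \<Rightarrow> bool" where
  "simple_graph V E \<longleftrightarrow> finite V \<and> (\<forall>e\<in>E. e \<subseteq> V \<and> card e = 2)"

definition is_cycle :: "'v set \<Rightarrow> 'v set set \<Rightarrow> 'v set set \<Rightarrow> bool" where
  "is_cycle V E C \<longleftrightarrow> C \<subseteq> E \<and> (\<forall>v\<in>V. even (card {e \<in> C. v \<in> e}))"

text \<open>
  A set of edges is identified with its indicator function, a vector over \<open>GF(2)\<close> (the
  library field \<^typ>\<open>bit\<close>); then vector addition is symmetric difference, see
  \<open>indicator_sym_diff\<close> below.
\<close>

definition scale_gf2 :: "bit \<Rightarrow> ('e \<Rightarrow> bit) \<Rightarrow> ('e \<Rightarrow> bit)" where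
  "scale_gf2 c f = (\<lambda>e. c * f e)"

interpretation gf2: vector_space "scale_gf2 :: bit \<Rightarrow> ('e \<Rightarrow> bit) \<Rightarrow> ('e \<Rightarrow> bit)"
  by unfold_locales
    (simp_all only: scale_gf2_def fun_eq_iff plus_fun_apply distrib_left distrib_right
      mult.assoc mult_1_left simp_thms)

abbreviation edge_vector :: "'e set \<Rightarrow> 'e \<Rightarrow> bit" where
  "edge_vector \<equiv> indicator"

lemma indicator_sym_diff:
  "edge_vector (sym_diff A B) = edge_vector A + edge_vector B"
  by (auto simp: fun_eq_iff indicator_def)

lemma inj_edge_vector: "inj edge_vector"
  by (auto simp: inj_def fun_eq_iff indicator_def of_bool_eq_iff)

definition is_cycle_basis :: "'v set \<Rightarrow> 'v set set \<Rightarrow> 'v set set set \<Rightarrow> bool" where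
  "is_cycle_basis V E M \<longleftrightarrow>
     gf2.independent (edge_vector ` M) \<and>
     gf2.span (edge_vector ` M) = edge_vector ` {C. is_cycle V E C}"

definition is_MCB :: "'v set \<Rightarrow> 'v set set \<Rightarrow> 'v set set set \<Rightarrow> bool" where
  "is_MCB V E M \<longleftrightarrow>
     is_cycle_basis V E M \<and>
     (\<forall>N. is_cycle_basis V E N \<longrightarrow> (\<Sum>B\<in>M. card B) \<le> (\<Sum>B\<in>N. card B))"

text \<open>
  Paths are given by their sequence of vertices.  As usual, a path has at least one vertex,
  and the one-vertex path without edges is allowed.
\<close>

definition is_path :: "'v set \<Rightarrow> 'v set set \<Rightarrow> 'v list \<Rightarrow> bool" where
  "is_path V E p \<longleftrightarrow>
     p \<noteq> [] \<and> distinct p \<and> set p \<subseteq> V \<and> successively (\<lambda>u v. {u, v} \<in> E) p"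

definition path_edges :: "'v list \<Rightarrow> 'v set set" where
  "path_edges p = {{p ! i, p ! Suc i} | i. Suc i < length p}"

text \<open>The vertices of a cycle \<open>C\<close> are the endpoints of its edges, i.e. \<open>\<Union>C\<close>.\<close>

definition intersect_in_path ::
    "'v set \<Rightarrow> 'v set set \<Rightarrow> 'v set set \<Rightarrow> 'v set set \<Rightarrow> bool" where
  "intersect_in_path V E C D \<longleftrightarrow>
     (\<exists>p. is_path V E p \<and> \<Union>C \<inter> \<Union>D = set p \<and> C \<inter> D = path_edges p)"

end

theory Submission
  imports Defs
begin

text \<open>
  If a member \<open>C\<close> of an MCB is a sum of two cycles, one of them can replace \<open>C\<close> in the basis,
  hence has at least \<open>card C\<close> edges.  It follows that the members are circuits and that the
  shorter of the two arcs between two vertices of a member is no longer than any other edge set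
  joining them.  Among all minimum replacements of \<open>C\<^sub>1\<close> that meet \<open>C\<^sub>2\<close>, take one, \<open>C\<close>, with the
  largest number of edges in common with \<open>C\<^sub>2\<close>.  For common vertices \<open>x \<noteq> y\<close>, the shorter arcs of
  \<open>C\<close> and \<open>C\<^sub>2\<close> have the same length, and exchanging an arc of \<open>C\<close> for the one of \<open>C\<^sub>2\<close> cannot
  create more common edges, so one of the arcs of \<open>C\<close> lies in \<open>C\<^sub>2\<close>.  Cutting \<open>C\<close> at an edge
  outside \<open>C\<^sub>2\<close> then shows that the common vertices form a segment of the remaining path.
\<close>

section \<open>Degree parity and symmetric differences\<close>

text \<open>This is the boundary of an edge set over GF(2). Arcs between \<open>x\<close> and
  \<open>y\<close> can be handled as edge sets with boundary \<open>{x, y}\<close>, without vertex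
  sequences.\<close>

definition odd_verts :: "'v set set \<Rightarrow> 'v set" where
  "odd_verts A = {v. odd (card {e \<in> A. v \<in> e})}"

lemma even_card_sym_diff:
  assumes "finite A" "finite B"
  shows "even (card (sym_diff A B)) \<longleftrightarrow> (even (card A) \<longleftrightarrow> even (card B))"
proof -
  have "card A = card (A \<inter> B) + card (A - B)" "card B = card (A \<inter> B) + card (B - A)"
    using assms card_Int_Diff[of A B] card_Int_Diff[of B A] by (simp_all add: Int_commute)
  moreover have "card (sym_diff A B) = card (A - B) + card (B - A)"
    using assms by (intro card_Un_disjoint) auto
  ultimately show ?thesis by auto
qed

lemma odd_verts_sym_diff:
  assumes "finite A" "finite B"
  shows "odd_verts (sym_diff A B) = sym_diff (odd_verts A) (odd_verts B)"
proof -
  have "{e \<in> sym_diff A B. v \<in> e} = sym_diff {e \<in> A. v \<in> e} {e \<in> B. v \<in> e}" for v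
    by auto
  then show ?thesis
    using assms by (auto simp: odd_verts_def even_card_sym_diff)
qed

lemma odd_verts_Diff:
  assumes "finite A" "B \<subseteq> A"
  shows "odd_verts (A - B) = sym_diff (odd_verts A) (odd_verts B)"
proof -
  have "sym_diff A B = A - B" using assms(2) by auto
  then show ?thesis
    using odd_verts_sym_diff[of A B] assms finite_subset by metis
qed

lemma odd_verts_empty [simp]: "odd_verts {} = {}"
  by (simp add: odd_verts_def)

lemma odd_verts_singleton [simp]: "odd_verts {e} = e"
proof -
  have "{f \<in> {e}. v \<in> f} = (if v \<in> e then {e} else {})" for v by auto
  then show ?thesis by (auto simp: odd_verts_def)
qed

lemma odd_verts_subset: "odd_verts A \<subseteq> \<Union>A"
proof
  fix v assume "v \<in> odd_verts A"
  then have "{e \<in> A. v \<in> e} \<noteq> {}"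
    unfolding odd_verts_def by (metis (mono_tags) card.empty even_zero mem_Collect_eq)
  then show "v \<in> \<Union>A" by auto
qed

lemma simple_graph_finite: "simple_graph V E \<Longrightarrow> finite E"
  unfolding simple_graph_def by (meson PowI finite_Pow_iff finite_subset subsetI)

text \<open>A vertex of odd degree lies on an edge and hence in \<open>V\<close>, so the parity
  condition can be stated without \<open>V\<close>.\<close>

lemma is_cycle_iff:
  assumes "simple_graph V E"
  shows "is_cycle V E C \<longleftrightarrow> C \<subseteq> E \<and> odd_verts C = {}"
proof -
  have "odd_verts C \<subseteq> V" if "C \<subseteq> E"
    using that assms odd_verts_subset[of C] unfolding simple_graph_def by blast
  then show ?thesis
    unfolding is_cycle_def odd_verts_def by blast
qed

lemma is_cycle_sym_diff:
  assumes "simple_graph V E" "A \<subseteq> E" "B \<subseteq> E" "odd_verts A = odd_verts B"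
  shows "is_cycle V E (sym_diff A B)"
proof -
  have "finite A" "finite B"
    using assms simple_graph_finite finite_subset by metis+
  then show ?thesis
    using assms by (auto simp: is_cycle_iff odd_verts_sym_diff)
qed

lemma card_sym_diff_le:
  assumes "finite A" "finite B"
  shows "card (sym_diff A B) \<le> card A + card B"
  by (rule order_trans[OF card_Un_le add_mono])
    (use assms in \<open>auto intro: card_mono\<close>)

text \<open>The symmetric difference falls short of \<open>card A + card B\<close> by twice the size
  of the intersection.\<close>

lemma disjoint_if_card_sym_diff_ge:
  assumes "finite A" "finite B" "card A + card B \<le> card (sym_diff A B)"
  shows "A \<inter> B = {}"
proof -
  have "sym_diff A B = (A \<union> B) - (A \<inter> B)" by auto
  then have "card (sym_diff A B) = card (A \<union> B) - card (A \<inter> B)"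
    using assms by (simp add: card_Diff_subset le_infI1)
  moreover have "card A + card B = card (A \<union> B) + card (A \<inter> B)"
    using assms card_Un_Int by blast
  ultimately have "card (A \<inter> B) = 0" using assms(3) by linarith
  then show ?thesis using assms by simp
qed

section \<open>Paths\<close>

lemma path_edges_Nil [simp]: "path_edges [] = {}"
  by (simp add: path_edges_def)

lemma path_edges_singleton [simp]: "path_edges [x] = {}"
  by (simp add: path_edges_def)

lemma path_edges_Cons [simp]:
  "path_edges (x # y # p) = insert {x, y} (path_edges (y # p))" (is "?L = ?R")
proof
  show "?L \<subseteq> ?R"
  proof
    fix f assume "f \<in> ?L"
    then obtain i where i: "f = {(x # y # p) ! i, (x # y # p) ! Suc i}" "Suc i < length (x # y # p)"
      unfolding path_edges_def by blast
    show "f \<in> ?R" using i by (cases i) (auto simp: path_edges_def)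
  qed
  have "path_edges (y # p) \<subseteq> ?L"
  proof
    fix f assume "f \<in> path_edges (y # p)"
    then obtain i where "f = {(y # p) ! i, (y # p) ! Suc i}" "Suc i < length (y # p)"
      unfolding path_edges_def by blast
    then have "f = {(x # y # p) ! Suc i, (x # y # p) ! Suc (Suc i)}
        \<and> Suc (Suc i) < length (x # y # p)" by simp
    then show "f \<in> ?L" unfolding path_edges_def by blast
  qed
  moreover have "{x, y} \<in> ?L"
    unfolding path_edges_def by (rule CollectI, rule exI[of _ 0]) simp
  ultimately show "?R \<subseteq> ?L" by simp
qed

lemma finite_path_edges [simp]: "finite (path_edges p)"
  by (induction p rule: induct_list012) auto

lemma Union_path_edges: "\<Union>(path_edges p) \<subseteq> set p"
  by (induction p rule: induct_list012) auto

lemma path_edges_drop: "path_edges (drop n p) \<subseteq> path_edges p"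
  unfolding path_edges_def by (fastforce simp: add.commute[of n])

text \<open>Prepending an edge moves one odd vertex to the new first vertex. The symmetric
  difference also covers the one-vertex path, whose two ends cancel.\<close>

lemma odd_verts_path_edges:
  assumes "p \<noteq> []" "distinct p"
  shows "odd_verts (path_edges p) = sym_diff {hd p} {last p}"
  using assms
proof (induction p rule: induct_list012)
  case (3 x y p)
  have "{x, y} \<notin> path_edges (y # p)"
    using Union_path_edges[of "y # p"] 3 by auto
  then have "path_edges (x # y # p) = sym_diff {{x, y}} (path_edges (y # p))"
    by auto
  then have "odd_verts (path_edges (x # y # p)) = sym_diff {x, y} (sym_diff {y} {last (y # p)})"
    using 3 odd_verts_sym_diff[of "{{x, y}}" "path_edges (y # p)"] by simp
  moreover have "last (y # p) \<noteq> x" using 3 by (metis distinct.simps(2) last_in_set list.discI)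
  ultimately show ?case using 3 by auto
qed auto

lemma successively_iff_path_edges:
  "successively (\<lambda>u v. {u, v} \<in> E) p \<longleftrightarrow> path_edges p \<subseteq> E"
  by (induction p rule: induct_list012) auto

lemma path_edges_segment:
  assumes "j < length p"
  shows "path_edges (drop i (take (Suc j) p)) = {{p ! k, p ! Suc k} | k. i \<le> k \<and> k < j}"
    (is "?L = ?R")
proof
  show "?L \<subseteq> ?R"
    unfolding path_edges_def using assms by fastforce
  show "?R \<subseteq> ?L"
  proof
    fix f assume "f \<in> ?R"
    then obtain k where k: "f = {p ! k, p ! Suc k}" "i \<le> k" "k < j" by blast
    then show "f \<in> ?L"
      unfolding path_edges_def using assms by (intro CollectI exI[of _ "k - i"]) auto
  qed
qed

text \<open>Deleting an edge \<open>{u, u'}\<close> moves the odd vertex from \<open>u\<close> to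
  \<open>u'\<close>, so induction on the number of edges yields a path from \<open>u'\<close> to
  \<open>w\<close> to be extended by \<open>u\<close>.\<close>

lemma odd_verts_path:
  assumes "finite A" "\<forall>e\<in>A. card e = 2" "odd_verts A = {u, w}" "u \<noteq> w"
  shows "\<exists>p. p \<noteq> [] \<and> distinct p \<and> hd p = u \<and> last p = w \<and> path_edges p \<subseteq> A"
  using assms
proof (induction "card A" arbitrary: A u rule: less_induct)
  case less
  have "u \<in> \<Union>A" using odd_verts_subset[of A] less.prems by auto
  then obtain f where f: "f \<in> A" "u \<in> f" by blast
  then obtain u' where u': "f = {u, u'}" "u' \<noteq> u"
    using less.prems(2) card_2_iff[of f] by (metis doubleton_eq_iff empty_iff insertE)
  show ?case
  proof (cases "u' = w")
    case True
    then show ?thesis using f u' less.prems by (intro exI[of _ "[u, w]"]) auto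
  next
    case False
    have "odd_verts (A - {f}) = {u', w}"
      using odd_verts_Diff[of A "{f}"] f u' less.prems False by auto
    moreover have "card (A - {f}) < card A"
      using f less.prems(1) by (meson card_Diff1_less)
    ultimately obtain p where p: "p \<noteq> []" "distinct p" "hd p = u'" "last p = w"
      "path_edges p \<subseteq> A - {f}"
      using less.hyps[of "A - {f}" u'] less.prems False by auto
    show ?thesis
    \<comment> \<open>If the path returns to \<open>u\<close>, its part before \<open>u\<close> is
      cut off instead.\<close>
    proof (cases "u \<in> set p")
      case True
      then obtain i where i: "i < length p" "p ! i = u" by (auto simp: in_set_conv_nth)
      then show ?thesis
        using p path_edges_drop[of i p]
        by (intro exI[of _ "drop i p"]) (auto simp: hd_drop_conv_nth)
    next
      case False
      then show ?thesis
        using p f u' by (intro exI[of _ "u # p"]) (cases p, auto)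
    qed
  qed
qed

section \<open>Exchanges in a minimum cycle basis\<close>

text \<open>Steinitz exchange: the expansion of \<open>X\<close> in the basis must involve
  \<open>C\<close>, so \<open>C\<close> is recovered from \<open>X\<close> and the other
  members.\<close>

lemma is_cycle_basis_exchange:
  assumes "is_cycle_basis V E M" "C \<in> M" "is_cycle V E X"
    and X: "edge_vector X \<notin> gf2.span (edge_vector ` (M - {C}))"
  shows "is_cycle_basis V E (insert X (M - {C}))"
proof -
  let ?N = "edge_vector ` (M - {C})"
  have M: "edge_vector ` M = insert (edge_vector C) ?N" using assms(2) by blast
  have ind: "gf2.independent ?N"
    using assms(1) unfolding is_cycle_basis_def by (meson gf2.independent_mono image_mono Diff_subset)
  have "edge_vector X \<in> gf2.span (insert (edge_vector C) ?N)"
    using assms(1,3) unfolding is_cycle_basis_def M by auto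
  then have C: "edge_vector C \<in> gf2.span (insert (edge_vector X) ?N)"
    using X by (rule gf2.in_span_insert)
  have "gf2.span (insert (edge_vector X) ?N) = gf2.span (insert (edge_vector C) ?N)"
    unfolding gf2.span_eq
    using C \<open>edge_vector X \<in> gf2.span (insert (edge_vector C) ?N)\<close>
    by (auto intro: gf2.span_base)
  moreover have "gf2.independent (insert (edge_vector X) ?N)"
    using ind X by (rule gf2.independent_insertI[rotated])
  ultimately show ?thesis
    using assms(1) unfolding is_cycle_basis_def M by simp
qed

lemma is_MCB_member:
  assumes "is_MCB V E M" "C \<in> M"
  shows "is_cycle V E C"
proof -
  have "edge_vector C \<in> gf2.span (edge_vector ` M)"
    using assms(2) by (auto intro: gf2.span_base)
  then have "edge_vector C \<in> edge_vector ` {C. is_cycle V E C}"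
    using assms(1) unfolding is_MCB_def is_cycle_basis_def by simp
  then show ?thesis using inj_edge_vector by (auto dest: injD)
qed

lemma is_MCB_finite:
  assumes "simple_graph V E" "is_MCB V E M"
  shows "finite M"
proof -
  have "M \<subseteq> Pow E" using is_MCB_member[OF assms(2)] unfolding is_cycle_def by blast
  then show ?thesis using simple_graph_finite[OF assms(1)] finite_subset by auto
qed

text \<open>By independence \<open>C\<close> is outside the span of the other members, so one of its
  summands is too. That summand can replace \<open>C\<close>, and comparing total lengths gives the
  rest.\<close>

lemma is_MCB_exchange:
  assumes sg: "simple_graph V E" and M: "is_MCB V E M" "C \<in> M"
    and AB: "is_cycle V E A" "is_cycle V E B" "C = sym_diff A B"
  shows "\<exists>X\<in>{A, B}. X \<notin> M - {C} \<and> card C \<le> card X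
           \<and> (card X = card C \<longrightarrow> is_MCB V E (insert X (M - {C})))"
proof -
  let ?N = "edge_vector ` (M - {C})"
  have ind: "gf2.independent (edge_vector ` M)"
    using M unfolding is_MCB_def is_cycle_basis_def by blast
  have "edge_vector ` M - {edge_vector C} = ?N"
    using inj_edge_vector M(2) by (auto dest: injD)
  then have "edge_vector C \<notin> gf2.span ?N"
    using ind M(2) unfolding gf2.dependent_def by auto
  then have "edge_vector A \<notin> gf2.span ?N \<or> edge_vector B \<notin> gf2.span ?N"
    unfolding AB(3) indicator_sym_diff using gf2.span_add by blast
  then obtain X where X: "X \<in> {A, B}" "edge_vector X \<notin> gf2.span ?N" by blast
  \<comment> \<open>Otherwise inserting \<open>X\<close> would not add \<open>card X\<close> to the
    total length.\<close>
  then have new: "X \<notin> M - {C}" by (auto intro: gf2.span_base)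
  have basis: "is_cycle_basis V E (insert X (M - {C}))"
    using is_cycle_basis_exchange M X AB unfolding is_MCB_def by blast
  have fin: "finite M" using is_MCB_finite[OF sg M(1)] .
  have sum_X: "(\<Sum>B\<in>insert X (M - {C}). card B) = card X + (\<Sum>B\<in>M - {C}. card B)"
    using new fin by (intro sum.insert) auto
  have sum_M: "(\<Sum>B\<in>M. card B) = card C + (\<Sum>B\<in>M - {C}. card B)"
    using fin M(2) by (rule sum.remove)
  have "card C \<le> card X"
    using M(1) basis sum_X sum_M unfolding is_MCB_def by fastforce
  moreover have "is_MCB V E (insert X (M - {C}))" if "card X = card C"
    using M(1) basis sum_X sum_M that unfolding is_MCB_def by simp
  ultimately show ?thesis using X new by blast
qed

text \<open>A proper nonempty \<open>D\<close> would split \<open>C\<close> into two cycles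
  \<open>D\<close> and \<open>C - D\<close>, both shorter than \<open>C\<close>.\<close>

lemma is_MCB_minimal:
  assumes sg: "simple_graph V E" and M: "is_MCB V E M" "C \<in> M"
    and D: "D \<subseteq> C" "D \<noteq> {}" "odd_verts D = {}"
  shows "D = C"
proof (rule ccontr)
  assume "D \<noteq> C"
  have C: "C \<subseteq> E" "odd_verts C = {}"
    using is_MCB_member[OF M] is_cycle_iff[OF sg] by auto
  have fin: "finite C" using C simple_graph_finite[OF sg] finite_subset by blast
  have "is_cycle V E D" "is_cycle V E (C - D)"
    using is_cycle_iff[OF sg] C D odd_verts_Diff[OF fin D(1)] by auto
  moreover have "C = sym_diff D (C - D)" using D(1) by auto
  ultimately obtain X where "X \<in> {D, C - D}" "card C \<le> card X"
    using is_MCB_exchange[OF sg M] by meson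
  moreover have "card D < card C" "card (C - D) < card C"
    using fin D \<open>D \<noteq> C\<close> by (auto intro!: psubset_card_mono)
  ultimately show False by auto
qed

text \<open>Without \<open>e\<close>, exactly the ends of \<open>e\<close> have odd degree, so a
  path in \<open>C - {e}\<close> joins them. Together with \<open>e\<close> it has no odd vertices,
  so it exhausts \<open>C\<close> by minimality.\<close>

lemma is_MCB_circuit:
  assumes sg: "simple_graph V E" and M: "is_MCB V E M" "C \<in> M" and e: "e \<in> C"
  obtains p where "p \<noteq> []" "distinct p" "e = {hd p, last p}" "e \<notin> path_edges p"
    "C = insert e (path_edges p)" "\<Union>C = set p"
proof -
  have C: "C \<subseteq> E" "odd_verts C = {}"
    using is_MCB_member[OF M] is_cycle_iff[OF sg] by auto
  have fin: "finite C" using C simple_graph_finite[OF sg] finite_subset by blast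
  have card2: "\<forall>e\<in>C. card e = 2" using C sg unfolding simple_graph_def by blast
  then obtain u w where uw: "e = {u, w}" "u \<noteq> w" using e card_2_iff by metis
  have "odd_verts (C - {e}) = {u, w}"
    using odd_verts_Diff[OF fin, of "{e}"] e C uw by auto
  then obtain p where p: "p \<noteq> []" "distinct p" "hd p = u" "last p = w" "path_edges p \<subseteq> C - {e}"
    using odd_verts_path[of "C - {e}" u w] fin card2 uw by auto
  have "sym_diff {e} (path_edges p) = insert e (path_edges p)" using p(5) by auto
  then have "odd_verts (insert e (path_edges p)) = {}"
    using odd_verts_sym_diff[of "{e}" "path_edges p"] odd_verts_path_edges[OF p(1,2)] p uw by auto
  then have C_eq: "C = insert e (path_edges p)"
    using is_MCB_minimal[OF sg M, of "insert e (path_edges p)"] p e by auto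
  have "\<Union>C \<subseteq> set p"
    using C_eq Union_path_edges[of p] uw p hd_in_set last_in_set by fastforce
  moreover have "set p \<subseteq> \<Union>C"
  proof
    fix v assume "v \<in> set p"
    then obtain i where i: "i < length p" "p ! i = v" by (auto simp: in_set_conv_nth)
    show "v \<in> \<Union>C"
    \<comment> \<open>Every vertex but the last starts an edge of the path; the last one is an end
      of \<open>e\<close>.\<close>
    proof (cases "Suc i < length p")
      case True
      then have "{p ! i, p ! Suc i} \<in> path_edges p" unfolding path_edges_def by blast
      then show ?thesis using C_eq i by blast
    next
      case False
      then have "i = length p - 1" using i by simp
      then have "v = w" using p i by (simp add: last_conv_nth)
      then show ?thesis using uw e by blast
    qed
  qed
  ultimately show ?thesis using that[of p] p uw C_eq by blast
qed

lemma odd_verts_segment: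
  assumes "distinct p" "i < j" "j < length p"
  shows "odd_verts (path_edges (drop i (take (Suc j) p))) = {p ! i, p ! j}"
proof -
  let ?q = "drop i (take (Suc j) p)"
  have "?q \<noteq> []" "distinct ?q" "hd ?q = p ! i" "last ?q = p ! j"
    using assms by (auto simp: hd_drop_conv_nth last_conv_nth)
  moreover have "p ! i \<noteq> p ! j" using assms by (simp add: nth_eq_iff_index_eq)
  ultimately show ?thesis using odd_verts_path_edges[of ?q] by auto
qed

text \<open>A segment of the path obtained by cutting the circuit joins \<open>x\<close> and
  \<open>y\<close>, and so does its complement, as \<open>C\<close> has empty boundary. The shorter
  of the two is \<open>S\<close>.\<close>

lemma is_MCB_arc:
  assumes sg: "simple_graph V E" and M: "is_MCB V E M" "C \<in> M"
    and xy: "x \<in> \<Union>C" "y \<in> \<Union>C" "x \<noteq> y"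
  obtains S where "S \<subseteq> C" "odd_verts S = {x, y}" "card S \<le> card (C - S)"
proof -
  have C: "C \<subseteq> E" "odd_verts C = {}"
    using is_MCB_member[OF M] is_cycle_iff[OF sg] by auto
  have fin: "finite C" using C simple_graph_finite[OF sg] finite_subset by blast
  obtain e where "e \<in> C" using xy by blast
  then obtain p where p: "distinct p" "C = insert e (path_edges p)" "\<Union>C = set p"
    using is_MCB_circuit[OF sg M] by metis
  have ex: "\<exists>S\<subseteq>C. odd_verts S = {p ! i, p ! j}" if "i < j" "j < length p" for i j
  proof -
    have "path_edges (drop i (take (Suc j) p)) \<subseteq> path_edges p"
      unfolding path_edges_segment[OF that(2)] using that by (auto simp: path_edges_def)
    then show ?thesis
      using p odd_verts_segment[OF p(1) that] by blast
  qed
  obtain i j where ij: "i < length p" "j < length p" "p ! i = x" "p ! j = y"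
    using xy p(3) by (metis in_set_conv_nth)
  then have "i \<noteq> j" using xy by auto
  then obtain S where S: "S \<subseteq> C" "odd_verts S = {x, y}"
    using ex[of i j] ex[of j i] ij by (metis insert_commute nat_neq_iff)
  show ?thesis
  proof (cases "card S \<le> card (C - S)")
    case True
    then show ?thesis using that S by blast
  next
    case False
    moreover have "C - (C - S) = S" using S by blast
    moreover have "odd_verts (C - S) = {x, y}" using odd_verts_Diff[OF fin S(1)] C S by simp
    ultimately show ?thesis using that[of "C - S"] by auto
  qed
qed

text \<open>\<open>T\<close> closes each of the arcs \<open>R\<close> and \<open>C - R\<close> to a
  cycle, and \<open>T\<close> cancels in the sum of these two cycles, leaving
  \<open>C\<close>.\<close>

lemma is_MCB_arc_exchange:
  assumes sg: "simple_graph V E" and M: "is_MCB V E M" "C \<in> M"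
    and R: "R \<subseteq> C" and T: "T \<subseteq> E" "odd_verts T = odd_verts R"
  shows "\<exists>X\<in>{sym_diff R T, sym_diff (C - R) T}. X \<notin> M - {C} \<and> card C \<le> card X
           \<and> (card X = card C \<longrightarrow> is_MCB V E (insert X (M - {C})))"
proof (rule is_MCB_exchange[OF sg M])
  have C: "C \<subseteq> E" "odd_verts C = {}"
    using is_MCB_member[OF M] is_cycle_iff[OF sg] by auto
  have fin: "finite C" using C simple_graph_finite[OF sg] finite_subset by blast
  show "is_cycle V E (sym_diff R T)" "is_cycle V E (sym_diff (C - R) T)"
    using odd_verts_Diff[OF fin R] C R T by (auto intro!: is_cycle_sym_diff[OF sg])
  show "C = sym_diff (sym_diff R T) (sym_diff (C - R) T)" using R by auto
qed

text \<open>One of the two cycles closed by \<open>T\<close> has at least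
  \<open>card R + card (C - R)\<close> edges, but each has at most
  \<open>card (C - R) + card T\<close>.\<close>

lemma is_MCB_isometric:
  assumes sg: "simple_graph V E" and M: "is_MCB V E M" "C \<in> M"
    and R: "R \<subseteq> C" "card R \<le> card (C - R)" and T: "T \<subseteq> E" "odd_verts T = odd_verts R"
  shows "card R \<le> card T"
proof -
  have "C \<subseteq> E" using is_MCB_member[OF M] is_cycle_iff[OF sg] by auto
  then have fin: "finite C" "finite R" "finite T"
    using simple_graph_finite[OF sg] finite_subset R T by metis+
  have "card C = card R + card (C - R)"
    using fin R by (metis card_Int_Diff inf.absorb2)
  moreover obtain X where "X = sym_diff R T \<or> X = sym_diff (C - R) T" "card C \<le> card X"
    using is_MCB_arc_exchange[OF sg M R(1) T] by blast
  ultimately show ?thesis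
    using R fin card_sym_diff_le[of R T] card_sym_diff_le[of "C - R" T] by auto
qed

section \<open>Replacements sharing the most edges\<close>

text \<open>One arc of \<open>C\<close> can be traded for the shorter arc \<open>S\<close> of
  \<open>D\<close>. As this gains no common edges, the discarded arc was already inside
  \<open>D\<close>.\<close>

lemma arc_subset_of_maximal:
  assumes sg: "simple_graph V E" and M: "is_MCB V E M" "C \<in> M" "D \<in> M"
    and max: "\<And>X. X \<notin> M - {C} \<Longrightarrow> is_MCB V E (insert X (M - {C})) \<Longrightarrow> X \<inter> D \<noteq> {} \<Longrightarrow>
                card (X \<inter> D) \<le> card (C \<inter> D)"
    and R: "R \<subseteq> C" "odd_verts R = {x, y}" and xy: "x \<in> \<Union>D" "y \<in> \<Union>D" "x \<noteq> y"
  shows "R \<subseteq> D \<or> C - R \<subseteq> D"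
proof -
  have C: "C \<subseteq> E" "odd_verts C = {}" and D: "D \<subseteq> E"
    using is_MCB_member[OF M(1)] M(2,3) is_cycle_iff[OF sg] by auto
  have fin: "finite C" "finite D" using C D simple_graph_finite[OF sg] finite_subset by metis+
  obtain S where S: "S \<subseteq> D" "odd_verts S = {x, y}" "card S \<le> card (D - S)"
    using is_MCB_arc[OF sg M(1,3) xy] by metis
  have finS: "finite S" and "S \<noteq> {}" using S fin finite_subset by auto
  \<comment> \<open>Exchanging the arc \<open>C - A\<close> for \<open>S\<close>; if \<open>A\<close> is the shorter arc, this is possible only
      when both arcs are equally long.\<close>
  have step: "C - A \<subseteq> D"
    if A: "A \<subseteq> C" and len: "card S \<le> card (C - A)"
      and X: "X = sym_diff A S" "X \<notin> M - {C}" "card C \<le> card X"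
        "card X = card C \<longrightarrow> is_MCB V E (insert X (M - {C}))" for A X
  proof -
    have finA: "finite A" "finite (C - A)" using A fin finite_subset by auto
    have cC: "card C = card A + card (C - A)"
      using fin A by (metis card_Int_Diff inf.absorb2)
    have le: "card X \<le> card A + card S" using X(1) card_sym_diff_le finA finS by blast
    \<comment> \<open>\<open>card C \<le> card X \<le> card A + card S \<le> card A + card (C - A) =
      card C\<close>, so equality holds throughout.\<close>
    then have eq: "card S = card (C - A)" "card X = card C"
      using len cC X(3) by linarith+
    have disj: "A \<inter> S = {}"
      using disjoint_if_card_sym_diff_ge[OF finA(1) finS] cC X(1,3) eq by simp
    have "X \<inter> D = (A \<inter> D) \<union> S" using X(1) disj S(1) by auto
    then have cX: "card (X \<inter> D) = card (A \<inter> D) + card S"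
      using card_Un_disjoint[of "A \<inter> D" S] finA finS disj by auto
    have "C \<inter> D = (A \<inter> D) \<union> ((C - A) \<inter> D)" using A by auto
    then have "card (C \<inter> D) = card (A \<inter> D) + card ((C - A) \<inter> D)"
      using card_Un_disjoint[of "A \<inter> D" "(C - A) \<inter> D"] finA by auto
    moreover have "X \<inter> D \<noteq> {}" using \<open>X \<inter> D = (A \<inter> D) \<union> S\<close> \<open>S \<noteq> {}\<close> by blast
    \<comment> \<open>The overlaps of \<open>X\<close> and \<open>C\<close> with \<open>D\<close>
      share the term \<open>card (A \<inter> D)\<close>; maximality compares what remains, and
      \<open>card S = card (C - A)\<close>.\<close>
    ultimately have "card (C - A) \<le> card ((C - A) \<inter> D)"
      using max[of X] X eq cX by auto
    then have "(C - A) \<inter> D = C - A"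
      using finA by (intro card_seteq) auto
    then show ?thesis by blast
  qed
  have main: "Q \<subseteq> D \<or> C - Q \<subseteq> D"
    if Q: "Q \<subseteq> C" "odd_verts Q = {x, y}" "card Q \<le> card (C - Q)" for Q
  proof -
    \<comment> \<open>With \<open>card Q \<le> card (C - Q)\<close> this meets the length condition
      of \<open>step\<close> whichever of the two arcs is discarded.\<close>
    have "card S \<le> card Q"
      using is_MCB_isometric[OF sg M(1,3) S(1,3)] Q S(2) C by auto
    moreover have "C - (C - Q) = Q" using Q by blast
    moreover have "S \<subseteq> E" "odd_verts S = odd_verts Q" using S Q D by auto
    then obtain X where "X = sym_diff Q S \<or> X = sym_diff (C - Q) S" and
      X: "X \<notin> M - {C}" "card C \<le> card X" "card X = card C \<longrightarrow> is_MCB V E (insert X (M - {C}))"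
      using is_MCB_arc_exchange[OF sg M(1,2) Q(1)] by (metis insertE singletonD)
    ultimately show ?thesis
      using step[of Q X] step[of "C - Q" X] Q(1,3) X by (metis Diff_subset order_trans)
  qed
  show ?thesis
  proof (cases "card R \<le> card (C - R)")
    case True
    then show ?thesis using main R by blast
  next
    case False
    moreover have "C - (C - R) = R" using R by blast
    moreover have "odd_verts (C - R) = {x, y}" using odd_verts_Diff[OF fin(1) R(1)] C R by simp
    ultimately show ?thesis using main[of "C - R"] by auto
  qed
qed

text \<open>Cut \<open>C\<close> at an edge \<open>e\<close> outside \<open>D\<close> and take the
  segment from the first to the last vertex on \<open>D\<close>. The complementary arc contains
  \<open>e\<close>, so it is the segment that lies in \<open>D\<close>.\<close>

lemma intersect_in_path_of_maximal:
  assumes sg: "simple_graph V E" and M: "is_MCB V E M" "C \<in> M" "D \<in> M" and "C \<noteq> D"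
    and max: "\<And>X. X \<notin> M - {C} \<Longrightarrow> is_MCB V E (insert X (M - {C})) \<Longrightarrow> X \<inter> D \<noteq> {} \<Longrightarrow>
                card (X \<inter> D) \<le> card (C \<inter> D)"
    and meet: "\<Union>C \<inter> \<Union>D \<noteq> {}"
  shows "intersect_in_path V E C D"
proof -
  have C: "C \<subseteq> E" "odd_verts C = {}"
    using is_MCB_member[OF M(1)] M(2) is_cycle_iff[OF sg] by auto
  have "C \<noteq> {}" using meet by auto
  \<comment> \<open>As \<open>D\<close> is itself a member of the basis, a nonempty cycle inside it
    would equal \<open>D\<close>.\<close>
  then have "\<not> C \<subseteq> D" using is_MCB_minimal[OF sg M(1,3), of C] C(2) \<open>C \<noteq> D\<close> by blast
  then obtain e where e: "e \<in> C" "e \<notin> D" by blast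
  obtain p where p: "distinct p" "e \<notin> path_edges p" "C = insert e (path_edges p)" "\<Union>C = set p"
    using is_MCB_circuit[OF sg M(1,2) e(1)] by metis
  define I where "I = {k. k < length p \<and> p ! k \<in> \<Union>D}"
  have finI: "finite I" and "I \<noteq> {}"
    using meet unfolding I_def p(4) by (auto simp: in_set_conv_nth)
  define i j where "i = Min I" and "j = Max I"
  have ij: "i \<in> I" "j \<in> I" and bounds: "\<And>k. k \<in> I \<Longrightarrow> i \<le> k \<and> k \<le> j"
    using finI \<open>I \<noteq> {}\<close> unfolding i_def j_def by auto
  have j: "i \<le> j" "j < length p" using ij bounds I_def by auto
  let ?q = "drop i (take (Suc j) p)"
  have q: "path_edges ?q = {{p ! k, p ! Suc k} | k. i \<le> k \<and> k < j}"
    using path_edges_segment[OF j(2)] .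
  have qC: "path_edges ?q \<subseteq> path_edges p"
    unfolding q using j by (auto simp: path_edges_def)
  \<comment> \<open>For \<open>i = j\<close> there is a single common vertex, and the segment is a
    path without edges.\<close>
  have qD: "path_edges ?q \<subseteq> D"
  proof (cases "i = j")
    case True
    then show ?thesis unfolding q by auto
  next
    case False
    then have "i < j" using j by simp
    moreover have "p ! i \<noteq> p ! j" using False j p(1) by (simp add: nth_eq_iff_index_eq)
    ultimately have "path_edges ?q \<subseteq> D \<or> C - path_edges ?q \<subseteq> D"
      using arc_subset_of_maximal[OF sg M max, of "path_edges ?q" "p ! i" "p ! j"]
        odd_verts_segment[OF p(1) _ j(2), of i] ij qC p(3) unfolding I_def by blast
    then show ?thesis using e p(2) qC by blast
  qed
  have "C \<inter> D \<subseteq> path_edges ?q"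
  proof
    fix f assume f: "f \<in> C \<inter> D"
    then have "f \<in> path_edges p" using e p(3) by blast
    then obtain k where k: "f = {p ! k, p ! Suc k}" "Suc k < length p"
      unfolding path_edges_def by blast
    then have "k \<in> I" "Suc k \<in> I" using f unfolding I_def by auto
    then show "f \<in> path_edges ?q" unfolding q using k bounds[of k] bounds[of "Suc k"] by auto
  qed
  then have edges: "C \<inter> D = path_edges ?q" using qC qD p(3) by blast
  have "set ?q = (!) p ` {i..j}"
  proof -
    have "set ?q = {?q ! k | k. k < length ?q}" by (rule set_conv_nth)
    also have "\<dots> = (!) p ` {i..j}"
    proof (intro equalityI subsetI)
      fix v assume "v \<in> (!) p ` {i..j}"
      then obtain k where "v = p ! k" "i \<le> k" "k \<le> j" by auto
      then show "v \<in> {?q ! k | k. k < length ?q}"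
        using j by (intro CollectI exI[of _ "k - i"]) auto
    qed (use j in auto)
    finally show ?thesis .
  qed
  moreover have "{i..j} = I"
  proof
    show "{i..j} \<subseteq> I"
    proof
      fix k assume k: "k \<in> {i..j}"
      show "k \<in> I"
      \<comment> \<open>Before position \<open>j\<close>, each vertex of the segment starts a
        segment edge, which lies in \<open>D\<close>.\<close>
      proof (cases "k = j")
        case False
        then have "{p ! k, p ! Suc k} \<in> path_edges ?q" unfolding q using k by auto
        then show ?thesis using qD k j unfolding I_def by auto
      qed (use ij in auto)
    qed
  qed (use bounds in auto)
  moreover have "\<Union>C \<inter> \<Union>D = (!) p ` I"
    unfolding p(4) I_def set_conv_nth by blast
  ultimately have verts: "\<Union>C \<inter> \<Union>D = set ?q" by simp
  have "set ?q \<subseteq> V" using verts C sg unfolding simple_graph_def by blast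
  moreover have "path_edges ?q \<subseteq> E" using edges C by blast
  ultimately have "is_path V E ?q"
    unfolding is_path_def successively_iff_path_edges using j p(1) by auto
  then show ?thesis unfolding intersect_in_path_def using verts edges by blast
qed

theorem theorem4:
  fixes V :: "'v set" and E :: "'v set set" and M :: "'v set set set"
    and C\<^sub>1 C\<^sub>2 :: "'v set set"
  assumes "simple_graph V E"
    and "is_MCB V E M"
    and "C\<^sub>1 \<in> M" and "C\<^sub>2 \<in> M" and "C\<^sub>1 \<noteq> C\<^sub>2"
    and "card (\<Union>C\<^sub>1 \<inter> \<Union>C\<^sub>2) \<ge> 2"
  shows "\<exists>C\<^sub>1'. is_cycle V E C\<^sub>1' \<and>
           is_MCB V E ((M - {C\<^sub>1}) \<union> {C\<^sub>1'}) \<and>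
           intersect_in_path V E C\<^sub>1' C\<^sub>2"
proof -
  define N where "N = M - {C\<^sub>1}"
  \<comment> \<open>\<open>N\<close> stays fixed while the replacement \<open>X\<close> varies.
    Requiring a common vertex excludes an empty intersection, which is not a path.\<close>
  define P where "P X \<longleftrightarrow> X \<notin> N \<and> is_MCB V E (insert X N) \<and> \<Union>X \<inter> \<Union>C\<^sub>2 \<noteq> {}" for X
  have "insert C\<^sub>1 N = M" using assms(3) N_def by auto
  then have "P C\<^sub>1" unfolding P_def using assms(2,6) N_def by auto
  moreover have "card (X \<inter> C\<^sub>2) \<le> card E" if "P X" for X
    using that is_MCB_member[of V E "insert X N" X] simple_graph_finite[OF assms(1)]
    unfolding P_def is_cycle_def by (intro card_mono) auto
  ultimately obtain C where C: "P C" and max: "\<And>X. P X \<Longrightarrow> card (X \<inter> C\<^sub>2) \<le> card (C \<inter> C\<^sub>2)"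
    using ex_has_greatest_nat[of P C\<^sub>1 "\<lambda>X. card (X \<inter> C\<^sub>2)" "Suc (card E)"]
    by (auto simp: less_Suc_eq_le)
  have MCB: "is_MCB V E (insert C N)" and new: "C \<notin> N" "insert C N - {C} = N"
    using C unfolding P_def by auto
  have "C\<^sub>2 \<in> N" using assms(4,5) N_def by auto
  have "intersect_in_path V E C C\<^sub>2"
  proof (rule intersect_in_path_of_maximal[OF assms(1) MCB])
    fix X assume X: "X \<notin> insert C N - {C}" "is_MCB V E (insert X (insert C N - {C}))"
      "X \<inter> C\<^sub>2 \<noteq> {}"
    then obtain e where e: "e \<in> X" "e \<in> C\<^sub>2" by blast
    \<comment> \<open>A common edge has ends, and these are common vertices as required by
      \<open>P\<close>.\<close>
    have "e \<in> E" using e X is_MCB_member[OF X(2), of X] unfolding is_cycle_def by auto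
    then have "e \<noteq> {}" using assms(1) unfolding simple_graph_def by force
    then have "P X" unfolding P_def using X e new by auto
    then show "card (X \<inter> C\<^sub>2) \<le> card (C \<inter> C\<^sub>2)" by (rule max)
  qed (use C \<open>C\<^sub>2 \<in> N\<close> new in \<open>auto simp: P_def\<close>)
  moreover have "is_cycle V E C" using is_MCB_member[OF MCB] by simp
  ultimately show ?thesis using MCB unfolding N_def by auto
qed

end
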